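(* Let $X=\prod_{i=1}^d X_i\subseteq\mathbb{R}^n$ with each $X_i\subseteq\mathbb{R}^{n_i}$ nonempty, closed and convex, $\sum_{i=1}^d n_i=n$, and suppose $X$ is bounded, with $\|x\|\le M$ for all $x\in X$ and some $M>0$. Let $f:\mathbb{R}^n\to\mathbb{R}$ be convex with bounded subgradients over $X$: $\|\tilde\nabla f(x)\|\le C_f$ for all $\tilde\nabla f(x)\in\partial f(x)$, $x\in X$, where $C_f>0$. Let $F:\mathbb{R}^n\to\mathbb{R}^n$ be continuous, monotone and bounded over $X$, with $\|F(x)\|\le C_F$ for all $x\in X$, where $C_F>0$. Suppose the optimal solution set of the problem of minimizing $f(x)$ subject to $x\in\mathrm{SOL}(X,F)$ is nonempty. Let $\{\bar x_k\}$ be generated by the (deterministic) a-IRG algorithm described in the context, with, for all $k\ge0$, $$\gamma_k=\frac{\gamma_0}{\sqrt{k+1}},\qquad \eta_k=\frac{\eta_0}{(k+1)^b},$$ where $\gamma_0>0$, $\eta_0>0$ and $0<b<0.5$. Then, for any $0\le r<1$, the following hold. (i) Let $x^*$ be an optimal solution of the problem of minimizing $f(x)$ subject to $x\in\mathrm{SOL}(X,F)$. Then for all integers $N\ge 2^{\frac{2}{1-r}}-1$, $$f(\bar x_N)-f(x^* )\le \frac{2-r}{\eta_0}\left(\frac{4M^2}{\gamma_0}+\frac{\gamma_0\left(C_F^2+\eta_0^2C_f^2\right)}{0.5-0.5r+b}\right)\frac{1}{(N+1)^{0.5-b}}.$$ (ii) For all integers $N\ge 2^{\frac{2}{1-r}}-1$,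 $$\mathrm{GAP}(\bar x_N)\le (2-r)\left(\frac{4M^2}{\gamma_0}+\frac{\gamma_0\left(C_F^2+\eta_0^2C_f^2\right)}{0.5-0.5r}+\frac{2C_fM\eta_0}{1-0.5r-b}\right)\frac{1}{(N+1)^{b}}.$$
   Context: Notation. $\|\cdot\|$ is the Euclidean norm; a vector $x\in\mathbb{R}^n$ is partitioned into blocks $x=(x^{(1)};\ldots;x^{(d)})$ with $x^{(i)}\in\mathbb{R}^{n_i}$; $F_i(x)\in\mathbb{R}^{n_i}$ is the $i$-th block of $F(x)$. $\mathcal{P}_S$ is the Euclidean projection onto a closed convex set $S$. $\tilde\nabla f(x)\in\partial f(x)$ denotes a subgradient of $f$ at $x$ and $\tilde\nabla_i f(x)$ its $i$-th block. $F$ is monotone on $X$ if $(F(x)-F(y))^T(x-y)\ge 0$ for all $x,y\in X$. $\mathrm{SOL}(X,F)$ is the set of all $x\in X$ with $F(x)^T(y-x)\ge 0$ for all $y\in X$. The dual gap function is $\mathrm{GAP}(x)=\sup_{y\in X}F(y)^T(x-y)$ for $x\in X$. Algorithm a-IRG. Input: an arbitrary initial point $x_0\in X$, $\bar x_0:=x_0$, positive sequences $\{\gamma_k\}$ and $\{\eta_k\}$, a scalar $0\le r<1$, $S_0:=\gamma_0^r$. For $k=0,1,\ldots$, for all $i\in\{1,\ldots,d\}$: $$x_{k+1}^{(i)}:=\mathcal{P}_{X_i}\!\left(x_k^{(i)}-\gamma_k\left(F_i(x_k)+\eta_k\tilde\nabla_i f(x_k)\right)\right),\qquad \tilde\nabla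 f(x_k)\in\partial f(x_k),$$ and then $$S_{k+1}:=S_k+\gamma_{k+1}^r,\qquad \bar x_{k+1}:=\frac{S_k\bar x_k+\gamma_{k+1}^r x_{k+1}}{S_{k+1}}.$$ *)

theory Defs
  imports "HOL-Analysis.Analysis"
begin

text \<open>
  Blocks. The coordinates \<open>'n\<close> of R^n are partitioned by a map \<open>blk :: 'n \<Rightarrow> 'd\<close>, so that
  the i-th block has dimension n_i = \<open>card {j. blk j = i}\<close>, which may vary with i. As there
  are no dependent types, R^{n_i} is represented by its isometric copy in \<open>real ^ 'n\<close>, the
  vectors vanishing outside block i.
\<close>

definition block_space :: "('n::finite \<Rightarrow> 'd) \<Rightarrow> 'd \<Rightarrow> (real ^ 'n) set" where
  "block_space blk i = {x. \<forall>j. blk j \<noteq> i \<longrightarrow> x $ j = 0}"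

definition block :: "('n::finite \<Rightarrow> 'd) \<Rightarrow> 'd \<Rightarrow> real ^ 'n \<Rightarrow> real ^ 'n" where
  "block blk i x = (\<chi> j. if blk j = i then x $ j else 0)"

definition block_product :: "('n::finite \<Rightarrow> 'd) \<Rightarrow> ('d \<Rightarrow> (real ^ 'n) set) \<Rightarrow> (real ^ 'n) set" where
  "block_product blk Xs = {x. \<forall>i. block blk i x \<in> Xs i}"

definition subdifferential :: "('a::real_inner \<Rightarrow> real) \<Rightarrow> 'a \<Rightarrow> 'a set" where
  "subdifferential f x = {g. \<forall>y. f y \<ge> f x + g \<bullet> (y - x)}"

text \<open>Monotone in the sense of operators on an inner product space, not of ordered sets.\<close>

definition monotone_operator_on :: "'a::real_inner set \<Rightarrow> ('a \<Rightarrow> 'a) \<Rightarrow> bool" where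
  "monotone_operator_on X F \<longleftrightarrow> (\<forall>x\<in>X. \<forall>y\<in>X. (F x - F y) \<bullet> (x - y) \<ge> 0)"

definition SOL :: "'a::real_inner set \<Rightarrow> ('a \<Rightarrow> 'a) \<Rightarrow> 'a set" where
  "SOL X F = {x \<in> X. \<forall>y\<in>X. F x \<bullet> (y - x) \<ge> 0}"

text \<open>Extended-real valued, so that the supremum is the true one without side conditions.\<close>

definition GAP :: "'a::real_inner set \<Rightarrow> ('a \<Rightarrow> 'a) \<Rightarrow> 'a \<Rightarrow> ereal" where
  "GAP X F x = (SUP y\<in>X. ereal (F y \<bullet> (x - y)))"

text \<open>
  \<open>g k\<close> is the subgradient of f selected at the iterate \<open>x k\<close>; the selection is arbitrary.
  The Euclidean projection onto a closed convex set is \<^const>\<open>closest_point\<close>.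
\<close>

definition a_IRG ::
  "('n::finite \<Rightarrow> 'd) \<Rightarrow> ('d \<Rightarrow> (real ^ 'n) set) \<Rightarrow> (real ^ 'n \<Rightarrow> real) \<Rightarrow> (real ^ 'n \<Rightarrow> real ^ 'n) \<Rightarrow>
   (nat \<Rightarrow> real) \<Rightarrow> (nat \<Rightarrow> real) \<Rightarrow> real \<Rightarrow>
   (nat \<Rightarrow> real ^ 'n) \<Rightarrow> (nat \<Rightarrow> real ^ 'n) \<Rightarrow> (nat \<Rightarrow> real) \<Rightarrow> (nat \<Rightarrow> real ^ 'n) \<Rightarrow> bool" where
  "a_IRG blk Xs f F \<gamma> \<eta> r x g S xbar \<longleftrightarrow>
     (\<forall>k. \<gamma> k > 0 \<and> \<eta> k > 0) \<and> 0 \<le> r \<and> r < 1 \<and>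
     x 0 \<in> block_product blk Xs \<and> xbar 0 = x 0 \<and> S 0 = \<gamma> 0 powr r \<and>
     (\<forall>k. g k \<in> subdifferential f (x k)) \<and>
     (\<forall>k i. block blk i (x (Suc k)) =
        closest_point (Xs i)
          (block blk i (x k) - \<gamma> k *\<^sub>R (block blk i (F (x k)) + \<eta> k *\<^sub>R block blk i (g k)))) \<and>
     (\<forall>k. S (Suc k) = S k + \<gamma> (Suc k) powr r) \<and>
     (\<forall>k. xbar (Suc k) =
        (S k *\<^sub>R xbar k + \<gamma> (Suc k) powr r *\<^sub>R x (Suc k)) /\<^sub>R S (Suc k))"

end

theory Submission
  imports Defs
begin

text \<open>
  The blockwise projection step is nonexpansive towards every point y of X, so one step gives
  a recursion for the squared distances to y. Multiplying it by an increasing weight,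
  namely \<open>\<gamma> k powr (r - 1) / \<eta> k\<close> for the objective and \<open>\<gamma> k powr (r - 1)\<close> for the gap, and
  summing leaves only the last weight times the squared diameter plus sums of powers of k + 1.
  Convexity moves the left side to the average, and the normalisation S N is at least
  \<open>(N + 1) * \<gamma> N powr r\<close> because the weights decrease.
  This crude bound already suffices for the factor 2 - r.
\<close>

text \<open>Every coordinate \<open>j\<close> lies in exactly one block, \<open>blk j\<close>, so
  after exchanging the two sums each inner sum has a single nonzero term.\<close>

lemma norm_block_decomp:
  fixes blk :: "'n::finite \<Rightarrow> 'd::finite"
  shows "(norm v)\<^sup>2 = (\<Sum>i\<in>UNIV. (norm (block blk i v))\<^sup>2)"
proof -
  have norm2: "(norm u)\<^sup>2 = (\<Sum>j\<in>UNIV. (u $ j)\<^sup>2)" for u :: "real ^ 'n"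
    by (simp add: norm_vec_def L2_set_def sum_nonneg)
  have "(\<Sum>i\<in>UNIV. (norm (block blk i v))\<^sup>2) =
        (\<Sum>i\<in>UNIV. \<Sum>j\<in>UNIV. if i = blk j then (v $ j)\<^sup>2 else 0)"
    by (auto simp: norm2 block_def intro!: sum.cong)
  also have "\<dots> = (\<Sum>j\<in>UNIV. \<Sum>i\<in>UNIV. if i = blk j then (v $ j)\<^sup>2 else 0)"
    by (rule sum.swap)
  finally show ?thesis
    by (simp add: norm2)
qed

lemma block_diff: "block blk i (u - v) = block blk i u - block blk i v"
  and block_add: "block blk i (u + v) = block blk i u + block blk i v"
  and block_scaleR: "block blk i (c *\<^sub>R u) = c *\<^sub>R block blk i u"
  by (auto simp: block_def vec_eq_iff)

text \<open>Each block of \<open>y\<close> lies in \<open>Xs i\<close> and is therefore its own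
  projection, and projection onto a closed convex set is 1-Lipschitz. Squared block norms then add
  up to the full squared norm, so the blockwise step behaves like a projection onto the
  product.\<close>

lemma block_projection_nonexpansive:
  fixes blk :: "'n::finite \<Rightarrow> 'd::finite"
  assumes "\<And>i. closed (Xs i)" "\<And>i. convex (Xs i)"
    and "\<And>i. block blk i z = closest_point (Xs i) (block blk i u)"
    and "y \<in> block_product blk Xs"
  shows "norm (z - y) \<le> norm (u - y)"
proof -
  have "norm (block blk i (z - y)) \<le> norm (block blk i (u - y))" for i
  proof -
    have y: "block blk i y \<in> Xs i"
      using assms(4) by (simp add: block_product_def)
    have "dist (closest_point (Xs i) (block blk i u)) (closest_point (Xs i) (block blk i y))
          \<le> dist (block blk i u) (block blk i y)"
      using closest_point_lipschitz[of "Xs i"] assms(1,2) y by blast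
    then show ?thesis
      using y by (simp add: closest_point_self assms(3) dist_norm block_diff)
  qed
  then have "(norm (z - y))\<^sup>2 \<le> (norm (u - y))\<^sup>2"
    unfolding norm_block_decomp[of "z - y" blk] norm_block_decomp[of "u - y" blk]
    by (intro sum_mono power_mono) auto
  then show ?thesis
    by (rule power2_le_imp_le) simp
qed

lemma norm_add_squared_le:
  fixes u v :: "'a::real_inner"
  shows "(norm (u + v))\<^sup>2 \<le> 2 * (norm u)\<^sup>2 + 2 * (norm v)\<^sup>2"
proof -
  have "0 \<le> (u - v) \<bullet> (u - v)" by simp
  then show ?thesis
    by (simp add: power2_norm_eq_inner algebra_simps inner_commute)
qed

lemma norm_diff_scaleR_squared:
  fixes u v :: "'a::real_inner"
  shows "(norm (u - c *\<^sub>R v))\<^sup>2 = (norm u)\<^sup>2 - 2 * c * (v \<bullet> u) + c\<^sup>2 * (norm v)\<^sup>2"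
  unfolding power2_norm_eq_inner
  by (simp add: inner_diff_left inner_diff_right inner_commute[of u v] power2_eq_square
      right_diff_distrib)

text \<open>Summation by parts: the increments of \<open>w\<close> are nonnegative and each
  multiplies some \<open>a k\<close>, which is at most \<open>A\<close>, so these increments
  together with \<open>w 0 * a 0\<close> sum to at most \<open>w N * A\<close>.\<close>

lemma increasing_weight_telescope:
  fixes w a :: "nat \<Rightarrow> real"
  assumes "\<And>k. 0 \<le> w k" "\<And>k. w k \<le> w (Suc k)" "\<And>k. 0 \<le> a k" "\<And>k. a k \<le> A"
  shows "(\<Sum>k\<le>N. w k * (a k - a (Suc k))) \<le> w N * A"
proof -
  \<comment> \<open>The induction has to keep the final term \<open>a (Suc N)\<close>: the next
    summand starts with it, and it is discarded only afterwards.\<close>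
  have "(\<Sum>k\<le>N. w k * (a k - a (Suc k))) \<le> w N * (A - a (Suc N))"
  proof (induction N)
    case 0
    then show ?case
      using assms(1,4) by (simp add: mult_left_mono)
  next
    case (Suc N)
    have "w N * (A - a (Suc N)) \<le> w (Suc N) * (A - a (Suc N))"
      using assms(2,4) by (intro mult_right_mono) auto
    with Suc show ?case
      by (simp add: algebra_simps)
  qed
  also have "\<dots> \<le> w N * A"
    using assms(1,3) by (intro mult_left_mono) auto
  finally show ?thesis .
qed

text \<open>Weighted arithmetic-geometric mean inequality for \<open>t - 1\<close> and
  \<open>t\<close> with weights \<open>p\<close> and \<open>1 - p\<close>, multiplied by
  \<open>t powr (p - 1)\<close>. It replaces the comparison of a sum with an integral.\<close>

lemma powr_increment_ge:
  fixes t p :: real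
  assumes "1 \<le> t" "0 < p" "p \<le> 1"
  shows "p * t powr (p - 1) \<le> t powr p - (t - 1) powr p"
proof -
  have "(t - 1) powr p * t powr (1 - p) \<le> p * (t - 1) + (1 - p) * t"
  \<comment> \<open>Young's inequality is applied to positive numbers only; at \<open>t = 1\<close>
    the left side vanishes because \<open>0 powr p = 0\<close>.\<close>
  proof (cases "t = 1")
    case True
    then show ?thesis using assms by simp
  next
    case False
    then show ?thesis
      using Youngs_inequality_0[of p "1 - p" "t - 1" t] assms by simp
  qed
  then have "(t - 1) powr p * t powr (1 - p) \<le> t - p"
    by (simp add: algebra_simps)
  then have "(t - 1) powr p * t powr (1 - p) * t powr (p - 1) \<le> (t - p) * t powr (p - 1)"
    by (rule mult_right_mono) simp
  then have "(t - 1) powr p * (t powr (1 - p) * t powr (p - 1))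
             \<le> t * t powr (p - 1) - p * t powr (p - 1)"
    by (simp add: left_diff_distrib)
  moreover have "t powr (1 - p) * t powr (p - 1) = 1"
    using assms by (simp flip: powr_add)
  moreover have "t * t powr (p - 1) = t powr p"
    using assms by (simp add: powr_mult_base)
  ultimately show ?thesis
    by simp
qed

text \<open>The increments supplied by \<open>powr_increment_ge\<close> telescope, starting from the
  value 0 of \<open>t powr p\<close> at \<open>t = 0\<close>.\<close>

lemma sum_powr_le:
  fixes p :: real
  assumes "0 < p" "p \<le> 1"
  shows "(\<Sum>k\<le>N. (real k + 1) powr (p - 1)) \<le> (real N + 1) powr p / p"
proof -
  have step: "(real k + 1) powr (p - 1) \<le> ((real k + 1) powr p - real k powr p) / p" for k
    using powr_increment_ge[of "real k + 1" p] assms by (simp add: field_simps)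
  show ?thesis
  proof (induction N)
    case 0
    then show ?case using assms by simp
  next
    case (Suc N)
    then show ?case
      using step[of "Suc N"] by (simp add: diff_divide_distrib add.commute)
  qed
qed

text \<open>Jensen's inequality for the recursively defined average. Multiplying through by
  \<open>S N\<close> makes the induction step a two-point convexity inequality, with
  \<open>t\<close> the share of the newest iterate.\<close>

lemma convex_running_average:
  fixes h :: "'a::real_vector \<Rightarrow> real"
  assumes "convex_on UNIV h" "\<And>k. 0 < v k"
    and "S 0 = v 0" "xbar 0 = x 0" "\<And>k. S (Suc k) = S k + v (Suc k)"
    and "\<And>k. xbar (Suc k) = (S k *\<^sub>R xbar k + v (Suc k) *\<^sub>R x (Suc k)) /\<^sub>R S (Suc k)"
  shows "S N * h (xbar N) \<le> (\<Sum>k\<le>N. v k * h (x k))"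
proof (induction N)
  case 0
  then show ?case using assms(3,4) by simp
next
  case (Suc N)
  have S: "S k > 0" for k
    by (induction k) (use assms(2,3,5) in \<open>auto intro: add_pos_pos\<close>)
  define t where "t = v (Suc N) / S (Suc N)"
  have t: "0 \<le> t" "t \<le> 1" "1 - t = S N / S (Suc N)"
    using S[of N] assms(2)[of "Suc N"] by (simp_all add: t_def assms(5) field_simps)
  have "xbar (Suc N) = (1 - t) *\<^sub>R xbar N + t *\<^sub>R x (Suc N)"
    unfolding t(3) by (simp add: t_def assms(6) scaleR_add_right divide_inverse mult.commute)
  also have "h \<dots> \<le> (1 - t) * h (xbar N) + t * h (x (Suc N))"
    using convex_onD[OF assms(1) t(1,2)] by simp
  also have "\<dots> = (S N * h (xbar N) + v (Suc N) * h (x (Suc N))) / S (Suc N)"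
    unfolding t(3) by (simp add: t_def add_divide_distrib)
  finally have "S (Suc N) * h (xbar (Suc N)) \<le> S N * h (xbar N) + v (Suc N) * h (x (Suc N))"
    using S[of "Suc N"] by (simp add: pos_le_divide_eq mult.commute)
  with Suc show ?case by simp
qed

text \<open>Common skeleton of both rates: \<open>h\<close> will be the objective excess or a linear
  gap term, \<open>a\<close> the squared distance to a comparison point, \<open>w\<close> the
  increasing weight and \<open>e\<close> the error of one step.\<close>

lemma weighted_regret:
  fixes h :: "'a::real_vector \<Rightarrow> real"
  assumes "convex_on UNIV h" "\<And>k. 0 < v k"
    and "S 0 = v 0" "xbar 0 = x 0" "\<And>k. S (Suc k) = S k + v (Suc k)"
    and "\<And>k. xbar (Suc k) = (S k *\<^sub>R xbar k + v (Suc k) *\<^sub>R x (Suc k)) /\<^sub>R S (Suc k)"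
    and "\<And>k. 0 \<le> w k" "\<And>k. w k \<le> w (Suc k)" "\<And>k. 0 \<le> a k" "\<And>k. a k \<le> A"
    and "\<And>k. v k * h (x k) \<le> w k * (a k - a (Suc k)) + e k"
  shows "S N * h (xbar N) \<le> w N * A + (\<Sum>k\<le>N. e k)"
proof -
  have "S N * h (xbar N) \<le> (\<Sum>k\<le>N. v k * h (x k))"
    using assms(1-6) by (rule convex_running_average)
  also have "\<dots> \<le> (\<Sum>k\<le>N. w k * (a k - a (Suc k)) + e k)"
    by (intro sum_mono assms(11))
  also have "\<dots> = (\<Sum>k\<le>N. w k * (a k - a (Suc k))) + (\<Sum>k\<le>N. e k)"
    by (rule sum.distrib)
  also have "\<dots> \<le> w N * A + (\<Sum>k\<le>N. e k)"
    using increasing_weight_telescope[of w a A N] assms(7-10) by simp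
  finally show ?thesis .
qed

text \<open>Division by \<open>s\<close> comes first, and only then is \<open>s\<close> replaced by
  its lower bound in the nonnegative right side. Hence \<open>D\<close> may have either
  sign.\<close>

lemma powr_normalisation:
  fixes t D K c s p q :: real
  assumes "s * D \<le> c * (K * t powr q)" "c * t powr p \<le> s" "0 < c" "0 \<le> K" "1 \<le> t"
  shows "D \<le> K * t powr (q - p)"
proof -
  have s: "0 < c * t powr p" "0 < s"
    using assms by (auto intro: less_le_trans[OF _ assms(2)])
  have "D \<le> c * (K * t powr q) / s"
    using assms(1) s by (simp add: pos_le_divide_eq mult.commute)
  also have "\<dots> \<le> c * (K * t powr q) / (c * t powr p)"
    using assms s by (intro divide_left_mono) auto
  also have "\<dots> = K * t powr (q - p)"
    using assms(3) by (simp add: powr_diff)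
  finally show ?thesis .
qed

theorem corollary3p5:
  fixes blk :: "'n::finite \<Rightarrow> 'd::finite"
    and Xs :: "'d \<Rightarrow> (real ^ 'n) set" and X :: "(real ^ 'n) set"
    and f :: "real ^ 'n \<Rightarrow> real" and F :: "real ^ 'n \<Rightarrow> real ^ 'n"
    and M C\<^sub>f C\<^sub>F \<gamma>\<^sub>0 \<eta>\<^sub>0 b r :: real
    and \<gamma> \<eta> S :: "nat \<Rightarrow> real" and x g xbar :: "nat \<Rightarrow> real ^ 'n"
  assumes "\<And>i. Xs i \<subseteq> block_space blk i"
    and "\<And>i. Xs i \<noteq> {}" and "\<And>i. closed (Xs i)" and "\<And>i. convex (Xs i)"
    and "X = block_product blk Xs"
    and "M > 0" and "\<And>z. z \<in> X \<Longrightarrow> norm z \<le> M"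
    and "convex_on UNIV f"
    and "C\<^sub>f > 0" and "\<And>z h. z \<in> X \<Longrightarrow> h \<in> subdifferential f z \<Longrightarrow> norm h \<le> C\<^sub>f"
    and "continuous_on X F" and "monotone_operator_on X F"
    and "C\<^sub>F > 0" and "\<And>z. z \<in> X \<Longrightarrow> norm (F z) \<le> C\<^sub>F"
    and "\<exists>z. is_arg_min f (\<lambda>z. z \<in> SOL X F) z"
    and "\<gamma>\<^sub>0 > 0" and "\<eta>\<^sub>0 > 0" and "0 < b" and "b < 0.5" and "0 \<le> r" and "r < 1"
    and "\<And>k. \<gamma> k = \<gamma>\<^sub>0 / sqrt (real k + 1)"
    and "\<And>k. \<eta> k = \<eta>\<^sub>0 / (real k + 1) powr b"
    and "a_IRG blk Xs f F \<gamma> \<eta> r x g S xbar"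
  shows "(\<forall>xstar. is_arg_min f (\<lambda>z. z \<in> SOL X F) xstar \<longrightarrow>
           (\<forall>N::nat. real N \<ge> 2 powr (2 / (1 - r)) - 1 \<longrightarrow>
              f (xbar N) - f xstar \<le>
                (2 - r) / \<eta>\<^sub>0 *
                (4 * M\<^sup>2 / \<gamma>\<^sub>0 + \<gamma>\<^sub>0 * (C\<^sub>F\<^sup>2 + \<eta>\<^sub>0\<^sup>2 * C\<^sub>f\<^sup>2) / (0.5 - 0.5 * r + b)) *
                (1 / (real N + 1) powr (0.5 - b))))
       \<and> (\<forall>N::nat. real N \<ge> 2 powr (2 / (1 - r)) - 1 \<longrightarrow>
              GAP X F (xbar N) \<le> ereal (
                (2 - r) *
                (4 * M\<^sup>2 / \<gamma>\<^sub>0 + \<gamma>\<^sub>0 * (C\<^sub>F\<^sup>2 + \<eta>\<^sub>0\<^sup>2 * C\<^sub>f\<^sup>2) / (0.5 - 0.5 * r)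
                   + 2 * C\<^sub>f * M * \<eta>\<^sub>0 / (1 - 0.5 * r - b)) *
                (1 / (real N + 1) powr b)))"
proof -
  note alg = assms(24)[unfolded a_IRG_def]

  \<comment> \<open>Step sizes and averaging weights as powers of \<open>k + 1\<close>\<close>
  define C where "C = C\<^sub>F\<^sup>2 + \<eta>\<^sub>0\<^sup>2 * C\<^sub>f\<^sup>2"
  define n where "n k = real k + 1" for k
  define c where "c = \<gamma>\<^sub>0 powr r"
  define v where "v k = c * n k powr (- r / 2)" for k
  have n: "1 \<le> n k" "0 < n k" "n k \<le> n (Suc k)" for k
    by (simp_all add: n_def)
  have c: "0 < c" and C: "0 \<le> C"
    using assms(16) by (simp_all add: c_def C_def)
  have vpos: "0 < v k" for k
    using c n(2)[of k] by (simp add: v_def)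
  have \<gamma>pos: "0 < \<gamma> k" and \<eta>pos: "0 < \<eta> k" for k
    using alg by auto
  have \<gamma>_powr: "\<gamma> k = \<gamma>\<^sub>0 * n k powr (- 1 / 2)" for k
    using powr_minus_divide[of "n k" "1 / 2"] n(2)[of k] assms(22)[of k]
    by (simp add: powr_half_sqrt n_def)
  have \<eta>_powr: "\<eta> k = \<eta>\<^sub>0 * n k powr (- b)" for k
    using powr_minus_divide[of "n k" b] assms(23)[of k] by (simp add: n_def)
  \<comment> \<open>Uniformity in \<open>k\<close> is what lets the single constant \<open>C\<close>
    control all search directions.\<close>
  have \<eta>le: "\<eta> k \<le> \<eta>\<^sub>0" for k
  proof -
    have "n k powr (- b) \<le> n k powr 0"
      using n(1)[of k] assms(18) by (intro powr_mono) auto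
    then show ?thesis
      using assms(17) n(2)[of k] unfolding \<eta>_powr by (intro mult_left_le) auto
  qed
  have v: "\<gamma> k powr r = v k" for k
    using n(2)[of k] assms(16) by (simp add: \<gamma>_powr v_def c_def powr_mult powr_powr)
  \<comment> \<open>This quotient is \<gamma> k to the power \<open>r - 1\<close>; its exponent in
    \<open>n k\<close> is positive since \<open>r < 1\<close>, so it can serve as an increasing
    weight.\<close>
  have v_div: "v k / \<gamma> k = c / \<gamma>\<^sub>0 * n k powr (1 / 2 - r / 2)" for k
  proof -
    have "n k powr (- r / 2) = n k powr (1 / 2 - r / 2) * n k powr (- 1 / 2)"
      by (simp flip: powr_add)
    then show ?thesis
      using n(2)[of k] assms(16) by (simp add: v_def \<gamma>_powr)
  qed
  have v_times: "v k * \<gamma> k = c * \<gamma>\<^sub>0 * n k powr (- 1 / 2 - r / 2)" for k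
  proof -
    have "n k powr (- 1 / 2 - r / 2) = n k powr (- r / 2) * n k powr (- 1 / 2)"
      by (simp add: algebra_simps flip: powr_add)
    then show ?thesis
      by (simp add: v_def \<gamma>_powr)
  qed

  \<comment> \<open>Feasibility of the iterates and the one-step estimate\<close>
  have xX: "x k \<in> X" for k
  proof (cases k)
    case 0
    then show ?thesis using alg assms(5) by simp
  next
    case (Suc m)
    have "closest_point (Xs i) u \<in> Xs i" for i u
      using assms(2,3) by (rule closest_point_in_set[rotated])
    then show ?thesis
      using alg Suc by (simp add: assms(5) block_product_def)
  qed
  have g: "f (x k) + g k \<bullet> (y - x k) \<le> f y" "norm (g k) \<le> C\<^sub>f" for k y
  proof -
    have "g k \<in> subdifferential f (x k)"
      using alg by blast
    then show "f (x k) + g k \<bullet> (y - x k) \<le> f y" "norm (g k) \<le> C\<^sub>f"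
      using assms(10)[OF xX] by (simp_all add: subdifferential_def)
  qed

  \<comment> \<open>Expanding the projected step puts the factor \<open>2 * \<gamma> k\<close> on
    the inner product. Dividing by it halves the weight of the distance difference and cancels the 2
    in the bound \<open>2 * C\<close> for the squared direction.\<close>
  have step: "v k * ((F (x k) + \<eta> k *\<^sub>R g k) \<bullet> (x k - y))
      \<le> v k / \<gamma> k / 2 * ((norm (x k - y))\<^sup>2 - (norm (x (Suc k) - y))\<^sup>2) + v k * \<gamma> k * C"
    if "y \<in> X" for k y
  proof -
    define G where "G = F (x k) + \<eta> k *\<^sub>R g k"
    have "(norm G)\<^sup>2 \<le> 2 * (norm (F (x k)))\<^sup>2 + 2 * (norm (\<eta> k *\<^sub>R g k))\<^sup>2"
      unfolding G_def by (rule norm_add_squared_le)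
    also have "\<dots> \<le> 2 * C\<^sub>F\<^sup>2 + 2 * (\<eta>\<^sub>0 * C\<^sub>f)\<^sup>2"
      using assms(9,14,17) xX \<eta>le[of k] \<eta>pos[of k] g(2)[of k]
      by (intro add_mono mult_left_mono power_mono) (auto intro!: mult_mono)
    finally have G: "(norm G)\<^sup>2 \<le> 2 * C"
      by (simp add: C_def power_mult_distrib)
    have "norm (x (Suc k) - y) \<le> norm (x k - \<gamma> k *\<^sub>R G - y)"
      using that alg assms(3-5)
      by (intro block_projection_nonexpansive[of Xs blk])
         (auto simp: G_def block_diff block_add block_scaleR)
    then have "(norm (x (Suc k) - y))\<^sup>2 \<le> (norm ((x k - y) - \<gamma> k *\<^sub>R G))\<^sup>2"
      by (intro power_mono) (auto simp: algebra_simps)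
    also have "\<dots> = (norm (x k - y))\<^sup>2 - 2 * \<gamma> k * (G \<bullet> (x k - y)) + (\<gamma> k)\<^sup>2 * (norm G)\<^sup>2"
      by (rule norm_diff_scaleR_squared)
    also have "\<dots> \<le> (norm (x k - y))\<^sup>2 - 2 * \<gamma> k * (G \<bullet> (x k - y)) + (\<gamma> k)\<^sup>2 * (2 * C)"
      using G by (intro add_left_mono mult_left_mono) auto
    finally have "G \<bullet> (x k - y)
        \<le> ((norm (x k - y))\<^sup>2 - (norm (x (Suc k) - y))\<^sup>2) / (2 * \<gamma> k) + \<gamma> k * C"
      using \<gamma>pos[of k] by (simp add: field_simps power2_eq_square)
    then have "v k * (G \<bullet> (x k - y))
        \<le> v k * (((norm (x k - y))\<^sup>2 - (norm (x (Suc k) - y))\<^sup>2) / (2 * \<gamma> k) + \<gamma> k * C)"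
      using vpos[of k] by (intro mult_left_mono) auto
    then show ?thesis
      by (simp add: G_def distrib_left mult.assoc)
  qed

  have diam: "norm (y - z) \<le> 2 * M" if "y \<in> X" "z \<in> X" for y z
    using norm_triangle_ineq4[of y z] assms(7)[OF that(1)] assms(7)[OF that(2)] by linarith
  have diam2: "(norm (x k - y))\<^sup>2 \<le> 4 * M\<^sup>2" if "y \<in> X" for y k
    using power_mono[OF diam[OF xX[of k] that], of 2] by (simp add: power_mult_distrib)

  \<comment> \<open>Growth of the normalisation and rules for averages\<close>
  have S_ge: "c * n N powr (1 - r / 2) \<le> S N" for N
  proof -
    have "S N = (\<Sum>k\<le>N. v k)"
      by (induction N) (use alg v in auto)
    also have "\<dots> \<ge> (\<Sum>k\<le>N. c * n N powr (- r / 2))"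
      \<comment> \<open>The exponent \<open>- r / 2\<close> is nonpositive, so each of the
        \<open>N + 1\<close> weights is at least the last one.\<close>
      using c n assms(20) unfolding v_def
      by (intro sum_mono mult_left_mono powr_mono2') (auto simp: n_def)
    also have "(\<Sum>k\<le>N. c * n N powr (- r / 2)) = c * (n N * n N powr (- r / 2))"
      by (simp add: n_def algebra_simps)
    also have "\<dots> = c * n N powr (1 - r / 2)"
      using n(2)[of N] by (simp add: powr_mult_base)
    finally show ?thesis .
  qed
  have avg: "S 0 = v 0" "xbar 0 = x 0" "\<And>k. S (Suc k) = S k + v (Suc k)"
    "\<And>k. xbar (Suc k) = (S k *\<^sub>R xbar k + v (Suc k) *\<^sub>R x (Suc k)) /\<^sub>R S (Suc k)"
    using alg v by auto
  note regret = weighted_regret[OF _ vpos avg]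
  have sum_n: "(\<Sum>k\<le>N. n k powr (p - 1)) \<le> n N powr p / p" if "0 < p" "p \<le> 1" for p N
    using sum_powr_le[OF that] by (simp add: n_def)

  show ?thesis
  proof (intro conjI allI impI)

    \<comment> \<open>Rate for the objective\<close>
    fix z N
    assume z: "is_arg_min f (\<lambda>z. z \<in> SOL X F) z"
    \<comment> \<open>The weight \<open>v k / (\<gamma> k * \<eta> k)\<close> grows with exponent
      \<open>p\<close>, and the error \<open>v k * \<gamma> k / \<eta> k\<close> has exponent
      \<open>p - 1\<close>, as \<open>sum_n\<close> requires.\<close>
    define p where "p = 1 / 2 - r / 2 + b"
    have p: "0 < p" "p \<le> 1"
      using assms(18-21) by (simp_all add: p_def)
    define h where "h u = f u + (- f z)" for u
    have zX: "z \<in> X" and sol: "\<And>y. y \<in> X \<Longrightarrow> 0 \<le> F z \<bullet> (y - z)"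
      using z by (auto simp: is_arg_min_def SOL_def)
    have "S N * h (xbar N) \<le> c / (2 * \<gamma>\<^sub>0 * \<eta>\<^sub>0) * n N powr p * (4 * M\<^sup>2)
        + (\<Sum>k\<le>N. c * \<gamma>\<^sub>0 * C / \<eta>\<^sub>0 * n k powr (p - 1))"
    proof (rule regret)
      show "convex_on UNIV h"
        unfolding h_def using assms(8) by (intro convex_on_add) (auto simp: convex_on_const)
      show "0 \<le> c / (2 * \<gamma>\<^sub>0 * \<eta>\<^sub>0) * n k powr p" for k
        using c assms(16,17) by simp
      show "c / (2 * \<gamma>\<^sub>0 * \<eta>\<^sub>0) * n k powr p \<le> c / (2 * \<gamma>\<^sub>0 * \<eta>\<^sub>0) * n (Suc k) powr p" for k
        using c assms(16,17) n p less_imp_le[OF n(2)[of k]]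
        by (intro mult_left_mono powr_mono2) auto
      show "(norm (x k - z))\<^sup>2 \<le> 4 * M\<^sup>2" for k
        using zX by (rule diam2)
      show "v k * h (x k) \<le> c / (2 * \<gamma>\<^sub>0 * \<eta>\<^sub>0) * n k powr p
          * ((norm (x k - z))\<^sup>2 - (norm (x (Suc k) - z))\<^sup>2)
          + c * \<gamma>\<^sub>0 * C / \<eta>\<^sub>0 * n k powr (p - 1)" for k
      proof -
        have "0 \<le> (F (x k) - F z) \<bullet> (x k - z)"
          using assms(12) xX zX by (auto simp: monotone_operator_on_def)
        then have "0 \<le> F (x k) \<bullet> (x k - z)"
          using sol[OF xX[of k]] by (simp add: inner_diff_left)
        moreover have "\<eta> k * h (x k) \<le> \<eta> k * (g k \<bullet> (x k - z))"
          using g(1)[of k z] \<eta>pos[of k] by (intro mult_left_mono) (auto simp: h_def inner_diff_right)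
        ultimately have "\<eta> k * h (x k) \<le> (F (x k) + \<eta> k *\<^sub>R g k) \<bullet> (x k - z)"
          by (simp add: inner_add_left)
        then have "v k * (\<eta> k * h (x k)) \<le> v k * ((F (x k) + \<eta> k *\<^sub>R g k) \<bullet> (x k - z))"
          using vpos[of k] by (intro mult_left_mono) auto
        also note step[OF zX]
        \<comment> \<open>The objective enters the direction scaled by \<open>\<eta> k\<close>;
          dividing by this decaying factor costs \<open>b\<close> in the exponents of both the
          weight and the error.\<close>
        finally have "v k * h (x k) \<le> (v k / \<gamma> k / 2
            * ((norm (x k - z))\<^sup>2 - (norm (x (Suc k) - z))\<^sup>2) + v k * \<gamma> k * C) / \<eta> k"
          using \<eta>pos[of k] by (simp add: pos_le_divide_eq mult_ac)
        also have "\<dots> = v k / \<gamma> k / \<eta> k / 2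
            * ((norm (x k - z))\<^sup>2 - (norm (x (Suc k) - z))\<^sup>2) + v k * \<gamma> k / \<eta> k * C"
          by (simp add: add_divide_distrib)
        also have "v k / \<gamma> k / \<eta> k = c / (\<gamma>\<^sub>0 * \<eta>\<^sub>0) * n k powr p"
          unfolding v_div \<eta>_powr powr_minus_divide by (simp add: p_def powr_add)
        also have "v k * \<gamma> k / \<eta> k = c * \<gamma>\<^sub>0 / \<eta>\<^sub>0 * n k powr (p - 1)"
        proof -
          have "p - 1 = (- 1 / 2 - r / 2) + b"
            by (simp add: p_def)
          then show ?thesis
            unfolding v_times \<eta>_powr powr_minus_divide[of _ b] by (simp only: powr_add) simp
        qed
        finally show ?thesis
          by (simp add: mult_ac)
      qed
    qed simp
    also have "\<dots> \<le> c / (2 * \<gamma>\<^sub>0 * \<eta>\<^sub>0) * n N powr p * (4 * M\<^sup>2)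
        + c * \<gamma>\<^sub>0 * C / \<eta>\<^sub>0 * (n N powr p / p)"
      unfolding sum_distrib_left[symmetric] using sum_n[OF p] c C assms(16,17)
      by (intro add_left_mono mult_left_mono) auto
    also have "\<dots> = c * ((2 * M\<^sup>2 / \<gamma>\<^sub>0 + \<gamma>\<^sub>0 * C / p) / \<eta>\<^sub>0 * n N powr p)"
      using assms(16,17) p by (simp add: field_simps)
    finally have "h (xbar N) \<le> (2 * M\<^sup>2 / \<gamma>\<^sub>0 + \<gamma>\<^sub>0 * C / p) / \<eta>\<^sub>0 * n N powr (p - (1 - r / 2))"
      using S_ge[of N] c C p n assms(16,17) by (rule_tac powr_normalisation) auto
    \<comment> \<open>Passage to the stated constant: \<open>2 * M\<^sup>2\<close> is enlarged to
      \<open>4 * M\<^sup>2\<close>, and \<open>2 - r\<close> exceeds 1.\<close>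
    also have "\<dots> \<le> ((2 - r) * (4 * M\<^sup>2 / \<gamma>\<^sub>0 + \<gamma>\<^sub>0 * C / p)) / \<eta>\<^sub>0 * n N powr (p - (1 - r / 2))"
    proof -
      have "2 * M\<^sup>2 / \<gamma>\<^sub>0 + \<gamma>\<^sub>0 * C / p \<le> 1 * (4 * M\<^sup>2 / \<gamma>\<^sub>0 + \<gamma>\<^sub>0 * C / p)"
        using assms(16) by (simp add: divide_right_mono)
      also have "\<dots> \<le> (2 - r) * (4 * M\<^sup>2 / \<gamma>\<^sub>0 + \<gamma>\<^sub>0 * C / p)"
        using assms(16,21) C p by (intro mult_right_mono) auto
      finally show ?thesis
        using assms(17) by (intro mult_right_mono divide_right_mono) auto
    qed
    also have "n N powr (p - (1 - r / 2)) = 1 / n N powr (0.5 - b)"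
      using powr_minus_divide[of "n N" "0.5 - b"] by (simp add: p_def)
    also have "p = 0.5 - 0.5 * r + b"
      by (simp add: p_def)
    finally show "f (xbar N) - f z \<le> (2 - r) / \<eta>\<^sub>0 *
                (4 * M\<^sup>2 / \<gamma>\<^sub>0 + \<gamma>\<^sub>0 * (C\<^sub>F\<^sup>2 + \<eta>\<^sub>0\<^sup>2 * C\<^sub>f\<^sup>2) / (0.5 - 0.5 * r + b)) *
                (1 / (real N + 1) powr (0.5 - b))"
      by (simp add: h_def C_def n_def)
  next

    \<comment> \<open>Rate for the dual gap\<close>
    fix N
    \<comment> \<open>Here \<open>q\<close> is the exponent of the weight
      \<open>v k / \<gamma> k\<close>, while the regularisation error \<open>v k * \<eta> k\<close>
      has exponent \<open>s - 1\<close>. Since \<open>s - q = 1 / 2 - b\<close>, the power with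
      exponent \<open>s\<close> dominates.\<close>
    define q where "q = 1 / 2 - r / 2"
    define s where "s = 1 - r / 2 - b"
    have qs: "0 < q" "q \<le> 1" "0 < s" "s \<le> 1" "q \<le> s"
      using assms(18-21) by (simp_all add: q_def s_def)
    \<comment> \<open>\<open>K\<close> is the constant the argument yields, and \<open>K'\<close>
      the one in the statement without its factor \<open>2 - r\<close>.\<close>
    define K where "K = 2 * M\<^sup>2 / \<gamma>\<^sub>0 + \<gamma>\<^sub>0 * C / q + 2 * C\<^sub>f * M * \<eta>\<^sub>0 / s"
    define K' where "K' = 4 * M\<^sup>2 / \<gamma>\<^sub>0 + \<gamma>\<^sub>0 * C / q + 2 * C\<^sub>f * M * \<eta>\<^sub>0 / s"
    have K: "0 \<le> K" "K \<le> K'"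
      using assms(6,9,16,17) C qs by (auto simp: K_def K'_def divide_right_mono)
    have "F y \<bullet> (xbar N - y) \<le> (2 - r) * K' * (1 / n N powr b)" if y: "y \<in> X" for y
    proof -
      define h where "h u = F y \<bullet> (u - y)" for u
      have "S N * h (xbar N) \<le> c / (2 * \<gamma>\<^sub>0) * n N powr q * (4 * M\<^sup>2)
          + (\<Sum>k\<le>N. c * \<gamma>\<^sub>0 * C * n k powr (q - 1) + 2 * C\<^sub>f * M * c * \<eta>\<^sub>0 * n k powr (s - 1))"
      proof (rule regret)
        show "convex_on UNIV h"
          unfolding h_def by (intro convex_onI) (simp_all add: algebra_simps inner_simps)
        show "0 \<le> c / (2 * \<gamma>\<^sub>0) * n k powr q" for k
          using c assms(16) by simp
        show "c / (2 * \<gamma>\<^sub>0) * n k powr q \<le> c / (2 * \<gamma>\<^sub>0) * n (Suc k) powr q" for k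
          using c assms(16) n qs less_imp_le[OF n(2)[of k]]
          by (intro mult_left_mono powr_mono2) auto
        show "(norm (x k - y))\<^sup>2 \<le> 4 * M\<^sup>2" for k
          using y by (rule diam2)
        show "v k * h (x k) \<le> c / (2 * \<gamma>\<^sub>0) * n k powr q
            * ((norm (x k - y))\<^sup>2 - (norm (x (Suc k) - y))\<^sup>2)
            + (c * \<gamma>\<^sub>0 * C * n k powr (q - 1) + 2 * C\<^sub>f * M * c * \<eta>\<^sub>0 * n k powr (s - 1))" for k
        proof -
          have "0 \<le> (F (x k) - F y) \<bullet> (x k - y)"
            using assms(12) xX y by (auto simp: monotone_operator_on_def)
          then have "h (x k) \<le> F (x k) \<bullet> (x k - y)"
            by (simp add: h_def inner_diff_left)
          \<comment> \<open>For an arbitrary feasible \<open>y\<close> the subgradient term has no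
            sign, so it is bounded by Cauchy-Schwarz and the diameter \<open>2 * M\<close>; this is
            the source of the third summand of the gap constant.\<close>
          moreover have "- (g k \<bullet> (x k - y)) \<le> C\<^sub>f * (2 * M)"
          proof -
            have "- (g k \<bullet> (x k - y)) \<le> norm (g k) * norm (x k - y)"
              using Cauchy_Schwarz_ineq2[of "g k" "x k - y"] by linarith
            also have "\<dots> \<le> C\<^sub>f * (2 * M)"
              using g(2) diam[OF xX y] assms(9) by (intro mult_mono) auto
            finally show ?thesis .
          qed
          then have "\<eta> k * (- (g k \<bullet> (x k - y))) \<le> \<eta> k * (C\<^sub>f * (2 * M))"
            using \<eta>pos[of k] by (intro mult_left_mono) auto
          ultimately have "h (x k) \<le> (F (x k) + \<eta> k *\<^sub>R g k) \<bullet> (x k - y) + \<eta> k * (C\<^sub>f * (2 * M))"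
            by (simp add: inner_add_left)
          then have "v k * h (x k) \<le> v k * ((F (x k) + \<eta> k *\<^sub>R g k) \<bullet> (x k - y) + \<eta> k * (C\<^sub>f * (2 * M)))"
            using vpos[of k] by (intro mult_left_mono) auto
          then have "v k * h (x k) \<le> v k / \<gamma> k / 2
              * ((norm (x k - y))\<^sup>2 - (norm (x (Suc k) - y))\<^sup>2) + v k * \<gamma> k * C
              + v k * \<eta> k * (C\<^sub>f * (2 * M))"
            using step[OF y, of k] by (simp add: distrib_left mult.assoc)
          also have "v k * \<eta> k = c * \<eta>\<^sub>0 * n k powr (s - 1)"
          proof -
            have "s - 1 = - r / 2 + - b"
              by (simp add: s_def)
            then show ?thesis
              unfolding v_def \<eta>_powr by (simp only: powr_add mult_ac)
          qed
          finally show ?thesis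
            unfolding v_div v_times by (simp add: q_def mult_ac)
        qed
      qed simp
      also have "\<dots> = c / (2 * \<gamma>\<^sub>0) * n N powr q * (4 * M\<^sup>2)
          + (c * \<gamma>\<^sub>0 * C * (\<Sum>k\<le>N. n k powr (q - 1))
             + 2 * C\<^sub>f * M * c * \<eta>\<^sub>0 * (\<Sum>k\<le>N. n k powr (s - 1)))"
        by (simp add: sum.distrib sum_distrib_left)
      also have "\<dots> \<le> c / (2 * \<gamma>\<^sub>0) * n N powr q * (4 * M\<^sup>2)
          + (c * \<gamma>\<^sub>0 * C * (n N powr q / q) + 2 * C\<^sub>f * M * c * \<eta>\<^sub>0 * (n N powr s / s))"
        using sum_n qs c C assms(6,9,16,17)
        by (intro add_left_mono add_mono mult_left_mono) auto
      \<comment> \<open>Raising every exponent \<open>q\<close> to \<open>s\<close> collects all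
        terms under one power; after division by the normalisation its exponent is
        \<open>- b\<close>.\<close>
      also have "\<dots> \<le> c / (2 * \<gamma>\<^sub>0) * n N powr s * (4 * M\<^sup>2)
          + (c * \<gamma>\<^sub>0 * C * (n N powr s / q) + 2 * C\<^sub>f * M * c * \<eta>\<^sub>0 * (n N powr s / s))"
        using powr_mono[OF qs(5) n(1)[of N]] qs c C assms(6,9,16,17)
        by (intro add_mono mult_left_mono mult_right_mono divide_right_mono) auto
      also have "\<dots> = c * (K * n N powr s)"
        using assms(16) qs by (simp add: K_def field_simps)
      finally have "h (xbar N) \<le> K * n N powr (s - (1 - r / 2))"
        using S_ge[of N] c K n by (rule_tac powr_normalisation) auto
      also have "\<dots> \<le> ((2 - r) * K') * n N powr (s - (1 - r / 2))"
        using K assms(21) mult_mono[of 1 "2 - r" K K'] by (intro mult_right_mono) auto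
      also have "n N powr (s - (1 - r / 2)) = 1 / n N powr b"
        by (simp add: s_def powr_minus_divide)
      finally show ?thesis
        by (simp add: h_def)
    qed
    \<comment> \<open>The bound does not depend on \<open>y\<close>, so it passes to the
      supremum.\<close>
    then show "GAP X F (xbar N) \<le> ereal (
                (2 - r) *
                (4 * M\<^sup>2 / \<gamma>\<^sub>0 + \<gamma>\<^sub>0 * (C\<^sub>F\<^sup>2 + \<eta>\<^sub>0\<^sup>2 * C\<^sub>f\<^sup>2) / (0.5 - 0.5 * r)
                   + 2 * C\<^sub>f * M * \<eta>\<^sub>0 / (1 - 0.5 * r - b)) *
                (1 / (real N + 1) powr b))"
      unfolding GAP_def by (intro SUP_least) (simp add: K'_def C_def n_def q_def s_def)
  qed
qed

end
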